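(* Let $n\ge 1$ and let $L,U\subseteq[n]=\{1,\ldots,n\}$ with $L\cap U=\emptyset$. Then the number of parking functions of $1,\ldots,n$ such that for every $i\in L$ the $i$-th car parks in its preferred spot, for every $i\in U$ the $i$-th car does not park in its preferred spot, and there are no restrictions on the remaining cars, is \[ \bigg(\prod_{i\in L}(n+2-i)\bigg)\bigg(\prod_{i\in U}(i-1)\bigg)(n+1)^{n-|L|-|U|-1}. \]
   Context: There are $n$ spots labeled $1,\ldots,n$ in order along a one-way street, and $n$ cars entering one after another, car $i$ having preference $a_i\in\{1,\ldots,n\}$. Each car drives to its preferred spot and parks there if it is available; otherwise it moves forward and parks in the first available later spot, if any (if none, it fails to park). A parking function of $1,\ldots,n$ is a sequence of preferences $(a_1,\ldots,a_n)$ such that all $n$ cars are able to park. *)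

theory Defs
  imports Complex_Main "HOL-Library.FuncSet"
begin

text \<open>
  Cars and spots are both numbered from \<open>1\<close> to \<open>n\<close>. A sequence of preferences is a function
  \<open>a \<in> {1..n} \<rightarrow>\<^sub>E {1..n}\<close>; extensionality makes distinct functions distinct sequences, so that
  counting them is meaningful.
\<close>

text \<open>The spot taken by a car with preference \<open>p\<close> when the spots in \<open>S\<close> are occupied;
  \<open>None\<close> if the car fails to park.\<close>

definition park :: "nat \<Rightarrow> nat set \<Rightarrow> nat \<Rightarrow> nat option" where
  "park n S p =
     (if {p..n} - S = {} then None else Some (Min ({p..n} - S)))"

text \<open>The spots occupied after the cars \<open>1, \<dots>, k\<close> have entered. A car that fails to park
  leaves the set unchanged.\<close>

fun occupied :: "nat \<Rightarrow> (nat \<Rightarrow> nat) \<Rightarrow> nat \<Rightarrow> nat set" where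
  "occupied n a 0 = {}"
| "occupied n a (Suc k) =
     occupied n a k \<union> set_option (park n (occupied n a k) (a (Suc k)))"

text \<open>The outcome for car \<open>i\<close>, meant for \<open>1 \<le> i \<le> n\<close>.\<close>

definition parking_spot :: "nat \<Rightarrow> (nat \<Rightarrow> nat) \<Rightarrow> nat \<Rightarrow> nat option" where
  "parking_spot n a i = park n (occupied n a (i - 1)) (a i)"

definition parking_functions :: "nat \<Rightarrow> (nat \<Rightarrow> nat) set" where
  "parking_functions n =
     {a \<in> {1..n} \<rightarrow>\<^sub>E {1..n}. \<forall>i\<in>{1..n}. parking_spot n a i \<noteq> None}"

definition parks_in_preferred :: "nat \<Rightarrow> (nat \<Rightarrow> nat) \<Rightarrow> nat \<Rightarrow> bool" where
  "parks_in_preferred n a i \<longleftrightarrow> parking_spot n a i = Some (a i)"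

end

theory Submission
  imports Defs
begin

text \<open>
  Pollak's circle argument. Add a spot \<open>0\<close> and close the street to a circle of \<open>n + 1\<close> spots on
  which every car may prefer any spot. Every car now parks, so car \<open>i\<close> finds exactly \<open>i - 1\<close> spots
  taken, and it parks in its preferred spot iff that spot is not one of these; this counts the
  restricted circular preference sequences as a product. Exactly one spot stays empty, and by
  rotation each spot is equally often the empty one. The sequences that leave spot \<open>0\<close> empty are
  exactly the parking functions, and the cars park as they do on the street.
\<close>

section \<open>Parking on the circle\<close>

text \<open>The least \<open>j\<close> is the number of steps driven past the preferred spot. It is
  unspecified when every spot is taken, which is why \<open>circ_park_notin\<close> asks for a free
  spot \<open>y\<close>.\<close>

definition circ_park :: "nat \<Rightarrow> nat set \<Rightarrow> nat \<Rightarrow> nat" where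
  "circ_park n S p = (p + (LEAST j. (p + j) mod Suc n \<notin> S)) mod Suc n"

fun circ_occupied :: "nat \<Rightarrow> (nat \<Rightarrow> nat) \<Rightarrow> nat \<Rightarrow> nat set" where
  "circ_occupied n a 0 = {}"
| "circ_occupied n a (Suc k) =
     insert (circ_park n (circ_occupied n a k) (a (Suc k))) (circ_occupied n a k)"

lemma circ_park_le: "circ_park n S p \<le> n"
  unfolding circ_park_def using mod_less_divisor[of "Suc n"] by (simp add: less_Suc_eq_le)

lemma circ_park_notin:
  assumes "p \<le> n" "y \<le> n" "y \<notin> S"
  shows "circ_park n S p \<notin> S"
proof -
  \<comment> \<open>Witness for the \<open>LEAST\<close>: drive from \<open>p\<close> on to spot
    \<open>0\<close>, then \<open>y\<close> steps further. Going through \<open>0\<close> avoids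
    truncated subtraction when \<open>y < p\<close>.\<close>
  have "(p + (Suc n - p + y)) mod Suc n = (y + Suc n) mod Suc n"
    using assms by (simp add: algebra_simps)
  also have "\<dots> = y"
    using assms by (simp only: mod_add_self2) simp
  finally have "(p + (Suc n - p + y)) mod Suc n \<notin> S"
    using assms by simp
  then show ?thesis
    unfolding circ_park_def by (rule LeastI)
qed

lemma circ_occupied_subset: "circ_occupied n a k \<subseteq> {..n}"
  by (induction k) (auto simp: circ_park_le)

lemma finite_circ_occupied: "finite (circ_occupied n a k)"
  by (rule finite_subset[OF circ_occupied_subset]) simp

lemma circ_occupied_mono: "k \<le> m \<Longrightarrow> circ_occupied n a k \<subseteq> circ_occupied n a m"
  by (rule lift_Suc_mono_le[of "circ_occupied n a"]) auto

text \<open>Before each of the first \<open>n + 1\<close> cars some spot of the circle is still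
  free, so every one of these cars takes a new spot.\<close>

lemma card_circ_occupied:
  assumes "\<forall>i\<in>{1..k}. a i \<le> n" "k \<le> Suc n"
  shows "card (circ_occupied n a k) = k"
  using assms
proof (induction k)
  case (Suc k)
  let ?S = "circ_occupied n a k"
  have card: "card ?S = k"
    using Suc by simp
  then have "?S \<noteq> {..n}"
    using Suc.prems by auto
  then obtain y where "y \<le> n" "y \<notin> ?S"
    using circ_occupied_subset[of n a k] by blast
  then have "circ_park n ?S (a (Suc k)) \<notin> ?S"
    using circ_park_notin Suc.prems by simp
  then show ?case
    using card finite_circ_occupied by simp
qed simp

lemma circ_occupied_cong:
  assumes "\<And>i. i \<in> {1..k} \<Longrightarrow> a i = b i"
  shows "circ_occupied n a k = circ_occupied n b k"
  using assms by (induction k) auto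

section \<open>Comparison of the circle with the street\<close>

text \<open>Spot \<open>0\<close> comes right after spot \<open>n\<close>, so a car that runs off
  the end of the street meets \<open>0\<close> next and stops there if it is free. Spot
  \<open>0\<close> thus stands for \<open>None\<close>.\<close>

lemma circ_park_street:
  assumes "0 < p" "p \<le> n" "0 \<notin> S"
  shows "circ_park n S p = (case park n S p of None \<Rightarrow> 0 | Some y \<Rightarrow> y)"
proof (cases "{p..n} - S = {}")
  case True
  \<comment> \<open>It takes \<open>Suc n - p\<close> steps from \<open>p\<close> to reach
    \<open>0\<close>; any smaller number stays within \<open>{p..n}\<close>, where nothing is
    free.\<close>
  have "(LEAST j. (p + j) mod Suc n \<notin> S) = Suc n - p"
  proof (rule Least_equality)
    show "(p + (Suc n - p)) mod Suc n \<notin> S"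
      using assms by simp
    fix j assume j: "(p + j) mod Suc n \<notin> S"
    show "Suc n - p \<le> j"
    proof (rule ccontr)
      assume "\<not> ?thesis"
      then have "p + j \<in> {p..n} - S"
        using j assms by auto
      then show False
        using True by blast
    qed
  qed
  then show ?thesis
    using True assms by (simp add: circ_park_def park_def)
next
  case False
  define y where "y = Min ({p..n} - S)"
  have y: "y \<in> {p..n} - S"
    unfolding y_def using False by (intro Min_in) auto
  have "(LEAST j. (p + j) mod Suc n \<notin> S) = y - p"
  proof (rule Least_equality)
    show "(p + (y - p)) mod Suc n \<notin> S"
      using y by simp
    fix j assume j: "(p + j) mod Suc n \<notin> S"
    show "y - p \<le> j"
    proof (rule ccontr)
      assume "\<not> ?thesis"
      then have *: "p + j < y" "p + j \<in> {p..n} - S"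
        using j y by auto
      from *(2) have "y \<le> p + j"
        unfolding y_def by (intro Min_le) auto
      then show False
        using *(1) by simp
    qed
  qed
  then show ?thesis
    using False y unfolding circ_park_def park_def y_def[symmetric] by auto
qed

lemma circ_park_0: "0 \<notin> S \<Longrightarrow> circ_park n S 0 = 0"
  by (simp add: circ_park_def Least_eq_0)

lemma park_SomeD:
  assumes "park n S p = Some y"
  shows "y \<in> {p..n} - S"
proof -
  have ne: "{p..n} - S \<noteq> {}" and y: "y = Min ({p..n} - S)"
    using assms by (auto simp: park_def split: if_splits)
  show ?thesis
    unfolding y using ne by (intro Min_in) auto
qed

lemma park_eq_Some_self:
  assumes "p \<le> n"
  shows "park n S p = Some p \<longleftrightarrow> p \<notin> S"
proof
  assume "p \<notin> S"
  then have "p \<in> {p..n} - S"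
    using assms by simp
  moreover from this have "Min ({p..n} - S) = p"
    by (intro Min_eqI) auto
  ultimately show "park n S p = Some p"
    by (auto simp: park_def)
qed (use park_SomeD in blast)

text \<open>Spot \<open>0\<close> gets taken by the first car that prefers it or fails on the
  street, and then stays taken. Until that moment both processes fill the same spots. The two claims
  go through one induction because the next car can be compared only when the occupied sets agree so
  far.\<close>

lemma circ_occupied_eq_occupied:
  assumes "\<forall>i\<in>{1..k}. a i \<le> n"
  shows "(0 \<notin> circ_occupied n a k \<longleftrightarrow>
      (\<forall>i\<in>{1..k}. a i \<noteq> 0 \<and> parking_spot n a i \<noteq> None)) \<and>
    (0 \<notin> circ_occupied n a k \<longrightarrow> occupied n a k = circ_occupied n a k)"
  using assms
proof (induction k)
  case (Suc k)
  let ?S = "circ_occupied n a k" and ?p = "a (Suc k)"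
  have p: "?p \<le> n"
    using Suc.prems by simp
  have split: "{1..Suc k} = insert (Suc k) {1..k}"
    by auto
  have IH1: "0 \<notin> ?S \<longleftrightarrow> (\<forall>i\<in>{1..k}. a i \<noteq> 0 \<and> parking_spot n a i \<noteq> None)"
    and IH2: "0 \<notin> ?S \<Longrightarrow> occupied n a k = ?S"
    using Suc by auto
  have step: "circ_park n ?S ?p \<noteq> 0 \<longleftrightarrow> ?p \<noteq> 0 \<and> park n ?S ?p \<noteq> None"
    and set: "circ_park n ?S ?p \<noteq> 0 \<Longrightarrow> set_option (park n ?S ?p) = {circ_park n ?S ?p}"
    if "0 \<notin> ?S"
  proof -
    have "(circ_park n ?S ?p \<noteq> 0 \<longleftrightarrow> ?p \<noteq> 0 \<and> park n ?S ?p \<noteq> None) \<and>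
      (circ_park n ?S ?p \<noteq> 0 \<longrightarrow> set_option (park n ?S ?p) = {circ_park n ?S ?p})"
    proof (cases "?p = 0")
      case True
      then show ?thesis
        using that by (simp add: circ_park_0)
    next
      case False
      then have "circ_park n ?S ?p = (case park n ?S ?p of None \<Rightarrow> 0 | Some y \<Rightarrow> y)"
        using that p by (simp add: circ_park_street)
      \<comment> \<open>A spot found on the street is at least \<open>a (Suc k)\<close>, hence
        nonzero, and cannot be mistaken for the value \<open>0\<close> given to
        \<open>None\<close>.\<close>
      then show ?thesis
        using False park_SomeD[of n ?S ?p] by (cases "park n ?S ?p") auto
    qed
    then show "circ_park n ?S ?p \<noteq> 0 \<longleftrightarrow> ?p \<noteq> 0 \<and> park n ?S ?p \<noteq> None"
      and "circ_park n ?S ?p \<noteq> 0 \<Longrightarrow> set_option (park n ?S ?p) = {circ_park n ?S ?p}"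
      by blast+
  qed
  show ?case
  proof (intro conjI impI)
    show "0 \<notin> circ_occupied n a (Suc k) \<longleftrightarrow>
        (\<forall>i\<in>{1..Suc k}. a i \<noteq> 0 \<and> parking_spot n a i \<noteq> None)"
    proof (cases "0 \<in> ?S")
      case False
      then show ?thesis
        unfolding split using IH1 IH2 step by (simp add: parking_spot_def)
    qed (use IH1 split in auto)
    assume "0 \<notin> circ_occupied n a (Suc k)"
    then show "occupied n a (Suc k) = circ_occupied n a (Suc k)"
      using IH2 set by simp
  qed
qed simp_all

section \<open>Rotation of the circle\<close>

definition rotate_spot :: "nat \<Rightarrow> nat \<Rightarrow> nat \<Rightarrow> nat" where
  "rotate_spot n r x = (x + r) mod Suc n"

lemma rotate_spot_le: "rotate_spot n r x \<le> n"
  unfolding rotate_spot_def using mod_less_divisor[of "Suc n"] by (simp add: less_Suc_eq_le)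

text \<open>The amounts \<open>r\<close> and \<open>Suc n - r\<close> add up to one full turn; the
  second is the natural number replacing \<open>-r\<close>.\<close>

lemma rotate_spot_inverse:
  assumes "x \<le> n" "r \<le> n"
  shows "rotate_spot n r (rotate_spot n (Suc n - r) x) = x"
    and "rotate_spot n (Suc n - r) (rotate_spot n r x) = x"
proof -
  have "(x + r + (Suc n - r)) mod Suc n = x"
  proof -
    have "x + r + (Suc n - r) = x + Suc n"
      using assms by simp
    then have "(x + r + (Suc n - r)) mod Suc n = (x + Suc n) mod Suc n"
      by (rule arg_cong)
    also have "\<dots> = x"
      using assms by (simp only: mod_add_self2) simp
    finally show ?thesis .
  qed
  then show "rotate_spot n r (rotate_spot n (Suc n - r) x) = x"
    and "rotate_spot n (Suc n - r) (rotate_spot n r x) = x"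
    unfolding rotate_spot_def mod_add_left_eq by (simp_all only: ac_simps)
qed

lemma inj_on_rotate_spot: "r \<le> n \<Longrightarrow> inj_on (rotate_spot n r) {..n}"
  by (rule inj_on_inverseI[where g = "rotate_spot n (Suc n - r)"]) (simp add: rotate_spot_inverse)

lemma rotate_spot_mem_iff:
  assumes "r \<le> n" "x \<le> n" "S \<subseteq> {..n}"
  shows "rotate_spot n r x \<in> rotate_spot n r ` S \<longleftrightarrow> x \<in> S"
  using inj_on_image_mem_iff[OF inj_on_rotate_spot] assms by blast

text \<open>Driving \<open>j\<close> steps commutes with rotating, and a rotated spot is free in the
  rotated set iff the original was free, so both searches stop at the same \<open>j\<close>.\<close>

lemma circ_park_rotate:
  assumes "r \<le> n" "S \<subseteq> {..n}"
  shows "circ_park n (rotate_spot n r ` S) (rotate_spot n r p) = rotate_spot n r (circ_park n S p)"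
proof -
  have shift: "(rotate_spot n r p + j) mod Suc n = rotate_spot n r ((p + j) mod Suc n)" for j
    unfolding rotate_spot_def by (simp only: mod_add_left_eq) (simp only: ac_simps)
  have "(p + j) mod Suc n \<le> n" for j
    using mod_less_divisor[of "Suc n"] by (simp add: less_Suc_eq_le)
  then show ?thesis
    unfolding circ_park_def shift using assms by (simp add: rotate_spot_mem_iff)
qed

lemma circ_occupied_rotate:
  assumes "r \<le> n" "\<And>i. i \<in> {1..k} \<Longrightarrow> b i = rotate_spot n r (a i)"
  shows "circ_occupied n b k = rotate_spot n r ` circ_occupied n a k"
  using assms by (induction k) (auto simp: circ_park_rotate circ_occupied_subset)

section \<open>Counting the restricted circular sequences\<close>

text \<open>Product rule for successive choices: the set of admissible values for entry
  \<open>i\<close> may depend on the earlier entries, but its size depends on \<open>i\<close>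
  alone.\<close>

lemma card_PiE_history:
  fixes C :: "(nat \<Rightarrow> 'b) \<Rightarrow> nat \<Rightarrow> 'b set"
  assumes "finite B"
    and subset: "\<And>a i. C a i \<subseteq> B"
    and cong: "\<And>a b i. (\<And>j. j \<in> {1..<i} \<Longrightarrow> a j = b j) \<Longrightarrow> C a i = C b i"
    and card: "\<And>a i. a \<in> {1..<i} \<rightarrow> B \<Longrightarrow> i \<in> {1..k} \<Longrightarrow> card (C a i) = c i"
  shows "card {a \<in> {1..k} \<rightarrow>\<^sub>E B. \<forall>i\<in>{1..k}. a i \<in> C a i} = (\<Prod>i=1..k. c i)"
  using card
proof (induction k)
  case 0
  have "{a \<in> {1..0::nat} \<rightarrow>\<^sub>E B. \<forall>i\<in>{1..0}. a i \<in> C a i} = {\<lambda>x. undefined}"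
    by auto
  then show ?case
    by simp
next
  case (Suc k)
  define A where "A k = {a \<in> {1..k} \<rightarrow>\<^sub>E B. \<forall>i\<in>{1..k}. a i \<in> C a i}" for k
  \<comment> \<open>The bound includes \<open>Suc k\<close> itself, since \<open>C a i\<close> looks
    only at entries before \<open>i\<close>.\<close>
  have C_upd: "C (a(Suc k := x)) i = C a i" if "i \<le> Suc k" for a x i
    using that by (intro cong) auto
  have split: "{1..Suc k} = insert (Suc k) {1..k}"
    by auto
  have upd_undefined: "a(Suc k := undefined) = a" if "a \<in> A k" for a
    using that by (auto simp: A_def fun_eq_iff PiE_def extensional_def)
  \<comment> \<open>A sequence of length \<open>Suc k\<close> is one of length \<open>k\<close> with
    an admissible last entry. Extensionality forces the shortened sequence to be
    \<open>undefined\<close> at \<open>Suc k\<close>.\<close>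
  have "bij_betw (\<lambda>(a, x). a(Suc k := x)) (SIGMA a : A k. C a (Suc k)) (A (Suc k))"
  proof (rule bij_betwI[where g = "\<lambda>a. (a(Suc k := undefined), a (Suc k))"])
    show "(\<lambda>(a, x). a(Suc k := x)) \<in> (SIGMA a : A k. C a (Suc k)) \<rightarrow> A (Suc k)"
      using subsetD[OF subset] unfolding A_def split
      by (auto simp: C_upd PiE_def extensional_def)
    show "(\<lambda>a. (a(Suc k := undefined), a (Suc k))) \<in> A (Suc k) \<rightarrow> (SIGMA a : A k. C a (Suc k))"
      unfolding A_def split
      by (auto simp: C_upd PiE_def extensional_def)
  qed (auto simp: upd_undefined)
  then have "card (A (Suc k)) = card (SIGMA a : A k. C a (Suc k))"
    by (simp add: bij_betw_same_card)
  also have "\<dots> = (\<Sum>a\<in>A k. card (C a (Suc k)))"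
    using \<open>finite B\<close> subset unfolding A_def
    by (intro card_SigmaI) (auto intro: finite_PiE finite_subset)
  also have "\<dots> = (\<Sum>a\<in>A k. c (Suc k))"
    by (intro sum.cong Suc.prems) (auto simp: A_def)
  also have "\<dots> = (\<Prod>i=1..Suc k. c i)"
    using Suc by (simp add: A_def)
  finally show ?case
    by (simp add: A_def)
qed

text \<open>On the circle, parking in the preferred spot just means finding it free on arrival, so
  the restrictions are expressed by membership in the occupied set.\<close>

definition circ_sequences :: "nat \<Rightarrow> nat set \<Rightarrow> nat set \<Rightarrow> (nat \<Rightarrow> nat) set" where
  "circ_sequences n L U = {a \<in> {1..n} \<rightarrow>\<^sub>E {..n}.
     (\<forall>i\<in>L. a i \<notin> circ_occupied n a (i - 1)) \<and> (\<forall>i\<in>U. a i \<in> circ_occupied n a (i - 1))}"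

lemma finite_circ_sequences: "finite (circ_sequences n L U)"
  by (rule finite_subset[of _ "{1..n} \<rightarrow>\<^sub>E {..n}"]) (auto simp: circ_sequences_def intro: finite_PiE)

text \<open>Whatever happened before, car \<open>i\<close> finds \<open>i - 1\<close> of the
  \<open>n + 1\<close> spots taken. This leaves \<open>n + 2 - i\<close> choices for
  \<open>i\<close> in \<open>L\<close>, \<open>i - 1\<close> for \<open>i\<close> in
  \<open>U\<close>, and \<open>n + 1\<close> otherwise.\<close>

lemma card_circ_sequences:
  assumes "L \<subseteq> {1..n}" "U \<subseteq> {1..n}" "L \<inter> U = {}"
  shows "card (circ_sequences n L U) =
    (\<Prod>i\<in>L. n + 2 - i) * (\<Prod>i\<in>U. i - 1) * (n + 1) ^ (n - card L - card U)"
proof -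
  define C where "C a i = (if i \<in> L then {..n} - circ_occupied n a (i - 1)
    else if i \<in> U then circ_occupied n a (i - 1) else {..n})" for a i
  define c where "c i = (if i \<in> L then n + 2 - i else if i \<in> U then i - 1 else n + 1)" for i
  \<comment> \<open>Since \<open>C\<close> asks about \<open>L\<close> first, disjointness keeps the
    condition for \<open>U\<close> from being lost.\<close>
  have "a i \<in> C a i \<longleftrightarrow> (i \<in> L \<longrightarrow> a i \<notin> circ_occupied n a (i - 1)) \<and>
      (i \<in> U \<longrightarrow> a i \<in> circ_occupied n a (i - 1))" if "a \<in> {1..n} \<rightarrow>\<^sub>E {..n}" "i \<in> {1..n}" for a i
    using that assms(3) by (auto simp: C_def)
  then have "circ_sequences n L U = {a \<in> {1..n} \<rightarrow>\<^sub>E {..n}. \<forall>i\<in>{1..n}. a i \<in> C a i}"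
    using assms(1,2) unfolding circ_sequences_def by blast
  also have "card \<dots> = (\<Prod>i=1..n. c i)"
  proof (rule card_PiE_history)
    show "C a i \<subseteq> {..n}" for a i
      using circ_occupied_subset by (auto simp: C_def)
    show "C a i = C b i" if "\<And>j. j \<in> {1..<i} \<Longrightarrow> a j = b j" for a b i
    proof -
      have "circ_occupied n a (i - 1) = circ_occupied n b (i - 1)"
        using that by (intro circ_occupied_cong) auto
      then show ?thesis
        by (simp add: C_def)
    qed
    show "card (C a i) = c i" if "a \<in> {1..<i} \<rightarrow> {..n}" "i \<in> {1..n}" for a i
    proof -
      have "card (circ_occupied n a (i - 1)) = i - 1"
        using that by (intro card_circ_occupied) (auto simp: Pi_iff)
      then show ?thesis
        using that circ_occupied_subset[of n a] finite_circ_occupied[of n a]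
        by (auto simp: C_def c_def card_Diff_subset)
    qed
  qed simp
  also have "\<dots> = (\<Prod>i\<in>L. c i) * (\<Prod>i\<in>U. c i) * (\<Prod>i\<in>{1..n} - L - U. c i)"
  proof -
    have "finite L" "finite U"
      using assms finite_subset by blast+
    have "{1..n} = L \<union> U \<union> ({1..n} - L - U)"
      using assms by auto
    then have "(\<Prod>i=1..n. c i) = prod c (L \<union> U \<union> ({1..n} - L - U))"
      by (rule arg_cong)
    also have "\<dots> = prod c (L \<union> U) * prod c ({1..n} - L - U)"
      using \<open>finite L\<close> \<open>finite U\<close> by (intro prod.union_disjoint) auto
    finally show ?thesis
      using \<open>finite L\<close> \<open>finite U\<close> assms by (simp add: prod.union_disjoint)
  qed
  also have "(\<Prod>i\<in>L. c i) = (\<Prod>i\<in>L. n + 2 - i)"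
    by (intro prod.cong) (auto simp: c_def)
  also have "(\<Prod>i\<in>U. c i) = (\<Prod>i\<in>U. i - 1)"
    using assms by (intro prod.cong) (auto simp: c_def)
  also have "(\<Prod>i\<in>{1..n} - L - U. c i) = (\<Prod>i\<in>{1..n} - L - U. n + 1)"
    by (intro prod.cong) (auto simp: c_def)
  also have "\<dots> = (n + 1) ^ (n - card L - card U)"
  proof -
    have "card ({1..n} - L - U) = card ({1..n} - L) - card U"
      using assms finite_subset[of U] by (intro card_Diff_subset) auto
    also have "card ({1..n} - L) = n - card L"
      using assms finite_subset[of L] by (simp add: card_Diff_subset)
    finally show ?thesis
      by simp
  qed
  finally show ?thesis .
qed

section \<open>Equidistribution of the empty spot\<close>

text \<open>Rotating all preferences rotates the occupied set at every time. Whether a car finds its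
  preferred spot taken is therefore unchanged, and the empty spot rotates along.\<close>

lemma rotate_circ_sequences:
  assumes "L \<subseteq> {1..n}" "U \<subseteq> {1..n}" "r \<le> n" "v \<le> n"
    and a: "a \<in> circ_sequences n L U" "v \<notin> circ_occupied n a n"
  defines "b \<equiv> \<lambda>i\<in>{1..n}. rotate_spot n r (a i)"
  shows "b \<in> circ_sequences n L U" and "rotate_spot n r v \<notin> circ_occupied n b n"
proof -
  have occ: "circ_occupied n b k = rotate_spot n r ` circ_occupied n a k" if "k \<le> n" for k
    using that assms(3) by (intro circ_occupied_rotate) (auto simp: b_def)
  have mem: "b i \<in> circ_occupied n b (i - 1) \<longleftrightarrow> a i \<in> circ_occupied n a (i - 1)"
    if "i \<in> {1..n}" for i
  proof -
    have "a i \<le> n"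
      using a that by (auto simp: circ_sequences_def)
    moreover have "b i = rotate_spot n r (a i)"
      using that by (simp add: b_def)
    moreover have "circ_occupied n b (i - 1) = rotate_spot n r ` circ_occupied n a (i - 1)"
      using that by (intro occ) auto
    ultimately show ?thesis
      using assms(3) by (simp add: rotate_spot_mem_iff circ_occupied_subset)
  qed
  have "b \<in> {1..n} \<rightarrow>\<^sub>E {..n}"
    by (auto simp: b_def rotate_spot_le)
  moreover have "\<forall>i\<in>L. b i \<notin> circ_occupied n b (i - 1)"
    using a(1) assms(1) mem unfolding circ_sequences_def by blast
  moreover have "\<forall>i\<in>U. b i \<in> circ_occupied n b (i - 1)"
    using a(1) assms(2) mem unfolding circ_sequences_def by blast
  ultimately show "b \<in> circ_sequences n L U"
    by (simp add: circ_sequences_def)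
  show "rotate_spot n r v \<notin> circ_occupied n b n"
    using assms(3,4) a(2) by (simp add: occ rotate_spot_mem_iff circ_occupied_subset)
qed

lemma card_circ_sequences_empty_spot:
  assumes "L \<subseteq> {1..n}" "U \<subseteq> {1..n}" "v \<le> n"
  shows "card {a \<in> circ_sequences n L U. v \<notin> circ_occupied n a n} =
    card {a \<in> circ_sequences n L U. 0 \<notin> circ_occupied n a n}"
\<comment> \<open>For \<open>v = 0\<close> the claim is trivial; otherwise the amount
  \<open>Suc n - v\<close>, which moves \<open>v\<close> to \<open>0\<close>, meets the bound
  \<open>r \<le> n\<close> of the rotation lemmas.\<close>
proof (cases "v = 0")
  case False
  define rot where "rot r a = (\<lambda>i\<in>{1..n}. rotate_spot n r (a i))" for r and a :: "nat \<Rightarrow> nat"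
  have inverse: "rot r (rot s a) = a"
    if "\<And>x. x \<le> n \<Longrightarrow> rotate_spot n r (rotate_spot n s x) = x" "a \<in> circ_sequences n L U" for r s a
    using that by (auto simp: rot_def circ_sequences_def fun_eq_iff PiE_iff extensional_def)
  have "bij_betw (rot (Suc n - v)) {a \<in> circ_sequences n L U. v \<notin> circ_occupied n a n}
      {a \<in> circ_sequences n L U. 0 \<notin> circ_occupied n a n}"
  proof (rule bij_betwI[where g = "rot v"])
    have "rotate_spot n (Suc n - v) v = 0" "Suc n - v \<le> n"
      using \<open>v \<le> n\<close> False by (auto simp: rotate_spot_def)
    then show "rot (Suc n - v) \<in> {a \<in> circ_sequences n L U. v \<notin> circ_occupied n a n}
        \<rightarrow> {a \<in> circ_sequences n L U. 0 \<notin> circ_occupied n a n}"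
      using rotate_circ_sequences[OF assms(1,2), of "Suc n - v" v] assms(3) by (auto simp: rot_def)
    have "rotate_spot n v 0 = v"
      using \<open>v \<le> n\<close> by (simp add: rotate_spot_def)
    then show "rot v \<in> {a \<in> circ_sequences n L U. 0 \<notin> circ_occupied n a n}
        \<rightarrow> {a \<in> circ_sequences n L U. v \<notin> circ_occupied n a n}"
      using rotate_circ_sequences[OF assms, of 0] by (auto simp: rot_def)
  qed (use \<open>v \<le> n\<close> in \<open>auto intro!: inverse simp: rotate_spot_inverse\<close>)
  then show ?thesis
    by (rule bij_betw_same_card)
qed simp

text \<open>Double count the pairs of a sequence and a spot it leaves empty: \<open>n\<close> cars
  leave exactly one of \<open>n + 1\<close> spots empty, and each spot is empty for equally many
  sequences.\<close>

lemma card_circ_sequences_eq_Suc_times: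
  assumes "L \<subseteq> {1..n}" "U \<subseteq> {1..n}"
  shows "card (circ_sequences n L U) =
    Suc n * card {a \<in> circ_sequences n L U. 0 \<notin> circ_occupied n a n}"
proof -
  have one: "card {v \<in> {..n}. v \<notin> circ_occupied n a n} = 1" if "a \<in> circ_sequences n L U" for a
  proof -
    have "card (circ_occupied n a n) = n"
      using that by (intro card_circ_occupied) (auto simp: circ_sequences_def)
    then have "card ({..n} - circ_occupied n a n) = 1"
      by (simp add: card_Diff_subset circ_occupied_subset finite_circ_occupied)
    moreover have "{v \<in> {..n}. v \<notin> circ_occupied n a n} = {..n} - circ_occupied n a n"
      by (rule set_diff_eq[symmetric])
    ultimately show ?thesis
      by (simp only:)
  qed
  have "card (circ_sequences n L U) =
      (\<Sum>a\<in>circ_sequences n L U. card {v \<in> {..n}. v \<notin> circ_occupied n a n})"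
    using one by simp
  also have "\<dots> = (\<Sum>v\<le>n. card {a \<in> circ_sequences n L U. v \<notin> circ_occupied n a n})"
    by (rule sum_multicount_gen[where k = "\<lambda>v. card {a \<in> circ_sequences n L U. v \<notin> circ_occupied n a n}"])
       (rule finite_circ_sequences finite_atMost ballI refl)+
  also have "\<dots> = (\<Sum>v\<le>n. card {a \<in> circ_sequences n L U. 0 \<notin> circ_occupied n a n})"
    by (intro sum.cong refl card_circ_sequences_empty_spot assms) simp
  finally show ?thesis
    by simp
qed

section \<open>Return to parking functions\<close>

text \<open>If \<open>0\<close> stays empty, no car preferred it and none failed on the street. The
  preferences then lie in \<open>{1..n}\<close>, and the occupied sets of street and circle agree
  when each car arrives.\<close>

lemma parking_functions_eq_circ_sequences:
  assumes "L \<subseteq> {1..n}" "U \<subseteq> {1..n}"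
  shows "{a \<in> parking_functions n. (\<forall>i\<in>L. parks_in_preferred n a i) \<and>
      (\<forall>i\<in>U. \<not> parks_in_preferred n a i)} =
    {a \<in> circ_sequences n L U. 0 \<notin> circ_occupied n a n}"
proof -
  have pf: "a \<in> parking_functions n \<longleftrightarrow> a \<in> {1..n} \<rightarrow>\<^sub>E {..n} \<and> 0 \<notin> circ_occupied n a n" for a
  proof (cases "a \<in> {1..n} \<rightarrow>\<^sub>E {..n}")
    case True
    then have "\<forall>i\<in>{1..n}. a i \<le> n"
      by auto
    then show ?thesis
      using True circ_occupied_eq_occupied[of n a n]
      by (force simp: parking_functions_def PiE_iff Suc_le_eq)
  next
    case False
    then show ?thesis
      by (auto simp: parking_functions_def PiE_iff)
  qed
  have pref: "parks_in_preferred n a i \<longleftrightarrow> a i \<notin> circ_occupied n a (i - 1)"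
    if "a \<in> {1..n} \<rightarrow>\<^sub>E {..n}" "0 \<notin> circ_occupied n a n" "i \<in> {1..n}" for a i
  proof -
    have le: "\<forall>i\<in>{1..n}. a i \<le> n"
      using that by auto
    \<comment> \<open>Occupied sets only grow, so a spot empty at the end was empty when car
      \<open>i\<close> arrived.\<close>
    have "0 \<notin> circ_occupied n a (i - 1)"
      using that circ_occupied_mono[of "i - 1" n n a] by fastforce
    then have "occupied n a (i - 1) = circ_occupied n a (i - 1)"
      using le that(3) by (intro circ_occupied_eq_occupied[THEN conjunct2, rule_format]) auto
    then show ?thesis
      using le that(3) by (simp add: parks_in_preferred_def parking_spot_def park_eq_Some_self)
  qed
  show ?thesis
    unfolding pf circ_sequences_def using pref assms by blast
qed

theorem theorem2p1:
  fixes n :: nat and L U :: "nat set"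
  assumes "n \<ge> 1"
    and "L \<subseteq> {1..n}" and "U \<subseteq> {1..n}" and "L \<inter> U = {}"
  shows "real (card {a \<in> parking_functions n.
             (\<forall>i\<in>L. parks_in_preferred n a i) \<and> (\<forall>i\<in>U. \<not> parks_in_preferred n a i)})
         = (\<Prod>i\<in>L. real n + 2 - real i) * (\<Prod>i\<in>U. real i - 1)
           * (real n + 1) powi (int n - int (card L) - int (card U) - 1)"
proof -
  let ?P = "{a \<in> parking_functions n.
             (\<forall>i\<in>L. parks_in_preferred n a i) \<and> (\<forall>i\<in>U. \<not> parks_in_preferred n a i)}"
  \<comment> \<open>The count is kept multiplied by \<open>n + 1\<close>, which makes it an identity
    of natural numbers: the exponent in the claim is \<open>-1\<close> when \<open>L\<close> and
    \<open>U\<close> together cover \<open>{1..n}\<close>.\<close>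
  have "Suc n * card ?P =
      (\<Prod>i\<in>L. n + 2 - i) * (\<Prod>i\<in>U. i - 1) * (n + 1) ^ (n - card L - card U)"
    unfolding parking_functions_eq_circ_sequences[OF assms(2,3)]
    using card_circ_sequences_eq_Suc_times[OF assms(2,3)] card_circ_sequences[OF assms(2-4)]
    by simp
  then have "real (Suc n * card ?P) =
      real ((\<Prod>i\<in>L. n + 2 - i) * (\<Prod>i\<in>U. i - 1) * (n + 1) ^ (n - card L - card U))"
    by (rule arg_cong)
  \<comment> \<open>The truncated subtractions are exact because \<open>i \<le> n\<close> on
    \<open>L\<close> and \<open>1 \<le> i\<close> on \<open>U\<close>.\<close>
  moreover have "(\<Prod>i\<in>L. real (n + 2 - i)) = (\<Prod>i\<in>L. real n + 2 - real i)"
    using assms(2) by (intro prod.cong) (auto simp: of_nat_diff)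
  moreover have "(\<Prod>i\<in>U. real (i - 1)) = (\<Prod>i\<in>U. real i - 1)"
    using assms(3) by (intro prod.cong) (auto simp: of_nat_diff)
  \<comment> \<open>The factor \<open>n + 1\<close> absorbs the \<open>-1\<close> in the exponent.
    Disjointness gives \<open>card L + card U \<le> n\<close>, so the remaining exponent is a
    natural number.\<close>
  moreover have "(real n + 1) * (real n + 1) powi (int n - int (card L) - int (card U) - 1) =
      (real n + 1) ^ (n - card L - card U)"
  proof -
    have "finite L" "finite U"
      using assms finite_subset by blast+
    then have "card L + card U = card (L \<union> U)"
      using assms(4) by (simp add: card_Un_disjoint)
    also have "\<dots> \<le> n"
      using card_mono[of "{1..n}" "L \<union> U"] assms by simp
    finally have "int n - int (card L) - int (card U) = int (n - card L - card U)"
      by simp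
    then have "(real n + 1) * (real n + 1) powi (int n - int (card L) - int (card U) - 1) =
        (real n + 1) * (real n + 1) powi (int (n - card L - card U) - 1)"
      by (simp only:)
    also have "\<dots> = (real n + 1) powi (int (n - card L - card U) - 1 + 1)"
      by (rule power_int_add_1'[symmetric]) simp
    also have "\<dots> = (real n + 1) ^ (n - card L - card U)"
      by (simp only: diff_add_cancel power_int_of_nat)
    finally show ?thesis .
  qed
  ultimately have "(real n + 1) * real (card ?P) = (real n + 1) *
      ((\<Prod>i\<in>L. real n + 2 - real i) * (\<Prod>i\<in>U. real i - 1)
       * (real n + 1) powi (int n - int (card L) - int (card U) - 1))"
    by (simp only: of_nat_mult of_nat_prod of_nat_power of_nat_Suc of_nat_add of_nat_1
        mult.left_commute[of "real n + 1"] add.commute[of 1])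
  moreover have "real n + 1 \<noteq> 0"
    by simp
  ultimately show ?thesis
    by (simp only: mult_cancel_left) blast
qed

end
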